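(* Let $W=(W_1,\ldots,W_m)$ be a score vector with null set $\mathcal H_0$ such that every null score is nonzero almost surely. Fix $\alpha\in(0,1)$ and $\delta,\eta\in[0,1)$ with $\delta+\eta<\alpha$. Let $\mathcal D$ be (calibration) data independent of the testing scores $W$. Suppose $\widehat\Gamma\in[1,\infty]$ is $\mathcal D$-measurable and, on an event $A\in\sigma(\mathcal D)$ with $\mathbb P(A)\ge1-\eta$, $$\mathbb P(\Lambda_{\max}>\log\widehat\Gamma\mid\mathcal D)\le\delta\quad\text{whenever }\widehat\Gamma<\infty,$$ where $\Lambda_{\max}$ is defined in the context. Then running the knockoff+ threshold on $W$ at the level $q_{\rm run}=(\alpha-\delta-\eta)/\widehat\Gamma$, with $q_{\rm run}=0$ (no rejections) when $\widehat\Gamma=\infty$, gives $\mathrm{FDR}\le\alpha$.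
   Context: For $t>0$, put $N_+(t)=\#\{i:W_i\ge t\}$, $N_-(t)=\#\{i:W_i\le -t\}$, $\mathcal T=\{|W_i|:|W_i|>0\}$. The knockoff+ threshold at level $q$ is $\widehat t=\min\{t\in\mathcal T:(1+N_-(t))/(N_+(t)\vee1)\le q\}$, with $\widehat t=\infty$ if the set is empty; the rejection set is $\widehat{\mathcal R}=\{i:W_i\ge\widehat t\}$, and $\mathrm{FDR}=\mathbb E\{|\widehat{\mathcal R}\cap\mathcal H_0|/(|\widehat{\mathcal R}|\vee1)\}$, the expectation being over both $\mathcal D$ and $W$ when the level is random. Here $a\vee b=\max\{a,b\}$. $W_{-j}$ denotes all scores except $W_j$. For each null $j$, $$\Lambda_j=\log\frac{\mathbb P(W_j>0\mid|W_j|,W_{-j})}{\mathbb P(W_j<0\mid|W_j|,W_{-j})},\qquad \Lambda_{\max}=\max_{j\in\mathcal H_0}\Lambda_j,$$ with $\Lambda_j=+\infty$ if the denominator is zero, $\Lambda_j=-\infty$ if the numerator is zero, and $\max\varnothing=-\infty$. These are functions of the testing scores $W$; the probabilities defining $\Lambda_j$ are under the law of $W$. *)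

theory Defs
  imports "HOL-Probability.Probability"
begin

definition N_plus :: "real ^ 'm \<Rightarrow> real \<Rightarrow> nat" where
  "N_plus w t = card {i. w $ i \<ge> t}"

definition N_minus :: "real ^ 'm \<Rightarrow> real \<Rightarrow> nat" where
  "N_minus w t = card {i. w $ i \<le> - t}"

definition knockoff_threshold :: "real \<Rightarrow> real ^ 'm \<Rightarrow> ereal" where
  "knockoff_threshold q w =
     (let C = {t \<in> {\<bar>w $ i\<bar> | i. \<bar>w $ i\<bar> > 0}.
                (1 + real (N_minus w t)) / real (max (N_plus w t) 1) \<le> q}
      in if C = {} then \<infinity> else ereal (Min C))"

definition knockoff_rejections :: "real \<Rightarrow> real ^ 'm \<Rightarrow> 'm set" where
  "knockoff_rejections q w = {i. ereal (w $ i) \<ge> knockoff_threshold q w}"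

definition FDR :: "'a measure \<Rightarrow> 'm set \<Rightarrow> ('a \<Rightarrow> 'm set) \<Rightarrow> real" where
  "FDR M H0 R = (\<integral>\<omega>. real (card (R \<omega> \<inter> H0)) / real (max (card (R \<omega>)) 1) \<partial>M)"

text \<open>The map \<open>w \<mapsto> (\<bar>w\<^sub>j\<bar>, w\<^sub>-\<^sub>j)\<close>, with \<open>\<bar>w\<^sub>j\<bar>\<close> stored in coordinate \<open>j\<close>; \<open>sign_blind_algebra j\<close>
  is the \<open>\<sigma>\<close>-algebra it generates.\<close>

definition forget_sign :: "'m \<Rightarrow> real ^ 'm \<Rightarrow> real ^ 'm" where
  "forget_sign j w = (\<chi> i. if i = j then \<bar>w $ j\<bar> else w $ i)"

definition sign_blind_algebra :: "'m::finite \<Rightarrow> (real ^ 'm) measure" where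
  "sign_blind_algebra j = vimage_algebra UNIV (forget_sign j) borel"

text \<open>In the following, \<open>P\<close> is the law of the score vector. The conditional probabilities are
  fixed versions, so \<open>log_sign_odds\<close> is determined up to \<open>P\<close>-null sets.\<close>

definition prob_pos :: "(real ^ 'm::finite) measure \<Rightarrow> 'm \<Rightarrow> real ^ 'm \<Rightarrow> real" where
  "prob_pos P j = real_cond_exp P (sign_blind_algebra j) (indicator {w. w $ j > 0})"

definition prob_neg :: "(real ^ 'm::finite) measure \<Rightarrow> 'm \<Rightarrow> real ^ 'm \<Rightarrow> real" where
  "prob_neg P j = real_cond_exp P (sign_blind_algebra j) (indicator {w. w $ j < 0})"

definition log_sign_odds :: "(real ^ 'm::finite) measure \<Rightarrow> 'm \<Rightarrow> real ^ 'm \<Rightarrow> ereal" where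
  "log_sign_odds P j w =
     (if prob_neg P j w = 0 then \<infinity>
      else if prob_pos P j w = 0 then - \<infinity>
      else ereal (ln (prob_pos P j w / prob_neg P j w)))"

text \<open>The supremum over the empty set is \<open>- \<infinity>\<close> in \<^typ>\<open>ereal\<close>.\<close>

definition max_log_sign_odds ::
  "(real ^ 'm::finite) measure \<Rightarrow> 'm set \<Rightarrow> real ^ 'm \<Rightarrow> ereal" where
  "max_log_sign_odds P H0 w = (SUP j\<in>H0. log_sign_odds P j w)"

definition log_ereal :: "ereal \<Rightarrow> ereal" where
  "log_ereal \<gamma> = (if \<gamma> = \<infinity> then \<infinity> else ereal (ln (real_of_ereal \<gamma>)))"

definition run_level :: "real \<Rightarrow> real \<Rightarrow> real \<Rightarrow> ereal \<Rightarrow> real" where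
  "run_level \<alpha> \<delta> \<eta> \<gamma> = (if \<gamma> = \<infinity> then 0 else (\<alpha> - \<delta> - \<eta>) / real_of_ereal \<gamma>)"

end

theory Submission
  imports Defs
begin

text \<open>Fix \<open>q\<close> and \<open>g\<close>, and let \<open>T\<^sub>j\<close> be the threshold computed after replacing \<open>w\<^sub>j\<close> by
  \<open>\<bar>w\<^sub>j\<bar>\<close>. On the event \<open>\<Lambda>\<^sub>m\<^sub>a\<^sub>x \<le> log g\<close> the false discovery proportion is at most
  \<open>q\<close> times the sum over null \<open>j\<close> of \<open>1{w\<^sub>j > 0, \<bar>w\<^sub>j\<bar> \<ge> T\<^sub>j} / (1 + #{k \<noteq> j. w\<^sub>k \<le> - T\<^sub>j})\<close>.
  Apart from the sign of \<open>w\<^sub>j\<close>, the \<open>j\<close>-th term is a function of \<open>\<bar>w\<^sub>j\<bar>\<close> and the other scores,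
  so flipping that sign costs at most a factor \<open>g\<close> in expectation. After the flip all indices that
  contribute share the same \<open>T\<^sub>j\<close>, and the sum is at most \<open>1\<close>. This gives the bound \<open>q g\<close> for a
  fixed level (the leave-one-out argument of Barber, Candes and Samworth). Independence
  allows one to integrate it over the random \<open>\<Gamma>\<close>; the failure of \<open>\<Lambda>\<^sub>m\<^sub>a\<^sub>x \<le> log \<Gamma>\<close> costs \<open>\<delta>\<close> and
  the complement of \<open>A\<close> costs \<open>\<eta>\<close>.\<close>

section \<open>Measurability of coordinates and of sign forgetting\<close>

lemma measurable_vec_nth [measurable (raw)]:
  fixes f :: "'a \<Rightarrow> real ^ 'm::finite"
  assumes "f \<in> borel_measurable M"
  shows "(\<lambda>x. f x $ i) \<in> borel_measurable M"
  using assms borel_measurable_nth by (rule measurable_compose)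

lemma measurable_forget_sign [measurable]:
  "forget_sign j \<in> borel_measurable (borel :: (real ^ 'm::finite) measure)"
proof (rule borel_measurable_euclidean_space[THEN iffD2], rule ballI)
  fix b :: "real ^ 'm" assume "b \<in> Basis"
  then obtain k where b: "b = axis k 1" by (auto simp: Basis_vec_def)
  have "(\<lambda>w :: real ^ 'm. if k = j then \<bar>w $ j\<bar> else w $ k) \<in> borel_measurable borel"
    by measurable
  then show "(\<lambda>w. forget_sign j w \<bullet> b) \<in> borel_measurable borel"
    by (simp add: b forget_sign_def flip: cart_eq_inner_axis cong: if_cong)
qed

section \<open>The knockoff+ threshold as an attained minimum\<close>

lemma N_plus_eq_sum: "real (N_plus w t) = (\<Sum>i\<in>UNIV. if w $ i \<ge> t then 1 else 0)"
  for w :: "real ^ 'm::finite"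
  by (simp add: N_plus_def sum.If_cases)

lemma N_minus_eq_sum: "real (N_minus w t) = (\<Sum>i\<in>UNIV. if w $ i \<le> - t then 1 else 0)"
  for w :: "real ^ 'm::finite"
  by (simp add: N_minus_def sum.If_cases)

lemma real_of_nat_max_1: "real (max n 1) = max (real n) 1"
  by (simp add: of_nat_max)

definition estimated_fdp :: "real ^ 'm \<Rightarrow> real \<Rightarrow> real" where
  "estimated_fdp w t = (1 + real (N_minus w t)) / real (max (N_plus w t) 1)"

lemma estimated_fdp_pos: "estimated_fdp w t > 0"
  by (auto simp: estimated_fdp_def intro!: divide_pos_pos)

lemma knockoff_threshold_le:
  fixes w :: "real ^ 'm::finite"
  assumes "w $ i \<noteq> 0" "estimated_fdp w \<bar>w $ i\<bar> \<le> q"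
  shows "knockoff_threshold q w \<le> ereal \<bar>w $ i\<bar>"
proof -
  let ?C = "{t \<in> {\<bar>w $ i\<bar> | i. \<bar>w $ i\<bar> > 0}. (1 + real (N_minus w t)) / real (max (N_plus w t) 1) \<le> q}"
  have "finite ?C" by (rule finite_subset[of _ "range (\<lambda>i. \<bar>w $ i\<bar>)"]) auto
  moreover have "\<bar>w $ i\<bar> \<in> ?C" using assms by (auto simp: estimated_fdp_def)
  ultimately show ?thesis
    unfolding knockoff_threshold_def Let_def by (auto intro!: Min_le)
qed

lemma knockoff_threshold_cases:
  fixes w :: "real ^ 'm::finite"
  obtains (infinite) "knockoff_threshold q w = \<infinity>"
  | (attained) i where "w $ i \<noteq> 0" "estimated_fdp w \<bar>w $ i\<bar> \<le> q"
      "knockoff_threshold q w = ereal \<bar>w $ i\<bar>"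
proof -
  let ?C = "{t \<in> {\<bar>w $ i\<bar> | i. \<bar>w $ i\<bar> > 0}. (1 + real (N_minus w t)) / real (max (N_plus w t) 1) \<le> q}"
  show thesis
  proof (cases "?C = {}")
    case True
    then show thesis using infinite unfolding knockoff_threshold_def Let_def by simp
  next
    case False
    have "finite ?C" by (rule finite_subset[of _ "range (\<lambda>i. \<bar>w $ i\<bar>)"]) auto
    from Min_in[OF this False] obtain i where i: "Min ?C = \<bar>w $ i\<bar>" "w $ i \<noteq> 0"
      "estimated_fdp w (Min ?C) \<le> q"
      by (auto simp: estimated_fdp_def)
    have "knockoff_threshold q w = ereal (Min ?C)"
      unfolding knockoff_threshold_def Let_def using False by (subst if_not_P) auto
    with i attained show thesis by metis
  qed
qed

lemma knockoff_threshold_nonpos_level: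
  \<comment> \<open>The estimate has numerator at least 1, hence is positive, and no candidate meets
    a level \<le> 0. This is how level 0 gives no rejections when \<open>\<Gamma>\<close> is
    infinite.\<close>
  "q \<le> 0 \<Longrightarrow> knockoff_threshold q w = \<infinity>" for w :: "real ^ 'm::finite"
  using estimated_fdp_pos
  by (cases rule: knockoff_threshold_cases[of q w]) (auto simp: not_le[symmetric] dest: order.trans)

text \<open>Serves measurability: the candidate set in the definition varies with \<open>w\<close>,
  whereas indexing by coordinates, with value \<infinity> at infeasible ones, gives an infimum of a
  fixed finite family.\<close>

lemma knockoff_threshold_eq_INF:
  fixes w :: "real ^ 'm::finite"
  shows "knockoff_threshold q w =
    (INF i. if w $ i \<noteq> 0 \<and> estimated_fdp w \<bar>w $ i\<bar> \<le> q then ereal \<bar>w $ i\<bar> else \<infinity>)"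
proof (rule antisym)
  show "knockoff_threshold q w \<le>
    (INF i. if w $ i \<noteq> 0 \<and> estimated_fdp w \<bar>w $ i\<bar> \<le> q then ereal \<bar>w $ i\<bar> else \<infinity>)"
    by (rule INF_greatest) (auto intro: knockoff_threshold_le)
  show "(INF i. if w $ i \<noteq> 0 \<and> estimated_fdp w \<bar>w $ i\<bar> \<le> q then ereal \<bar>w $ i\<bar> else \<infinity>)
    \<le> knockoff_threshold q w"
  proof (cases rule: knockoff_threshold_cases[of q w])
    case infinite
    then show ?thesis by simp
  next
    case (attained i)
    then show ?thesis by (intro INF_lower2[of i]) auto
  qed
qed

lemma measurable_estimated_fdp:
  fixes f :: "'a \<Rightarrow> real ^ 'm::finite"
  assumes [measurable]: "f \<in> borel_measurable M" "g \<in> borel_measurable M"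
  shows "(\<lambda>x. estimated_fdp (f x) (g x)) \<in> borel_measurable M"
  unfolding estimated_fdp_def real_of_nat_max_1 N_plus_eq_sum N_minus_eq_sum by measurable

lemma measurable_knockoff_threshold [measurable]:
  fixes f :: "'a \<Rightarrow> real ^ 'm::finite"
  assumes [measurable]: "q \<in> borel_measurable M" "f \<in> borel_measurable M"
  shows "(\<lambda>x. knockoff_threshold (q x) (f x)) \<in> borel_measurable M"
proof -
  note [measurable] = measurable_estimated_fdp
  show ?thesis unfolding knockoff_threshold_eq_INF by measurable
qed

section \<open>False discovery proportion, leave-one-out weights and sign flips\<close>

definition fdp :: "'m set \<Rightarrow> 'm set \<Rightarrow> real" where
  "fdp H0 R = real (card (R \<inter> H0)) / real (max (card R) 1)"

lemma fdp_nonneg: "0 \<le> fdp H0 R"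
  by (simp add: fdp_def)

lemma fdp_le_1: "fdp H0 R \<le> 1" for R :: "'m::finite set"
  by (auto simp: fdp_def divide_simps intro!: le_max_iff_disj[THEN iffD2] card_mono)

lemma measurable_fdp_knockoff [measurable]:
  fixes f :: "'a \<Rightarrow> real ^ 'm::finite"
  assumes [measurable]: "q \<in> borel_measurable M" "f \<in> borel_measurable M"
  shows "(\<lambda>x. fdp H0 (knockoff_rejections (q x) (f x))) \<in> borel_measurable M"
proof -
  \<comment> \<open>The rejection set enters only through cardinalities, which are finite sums of
    indicators; \<open>H = UNIV\<close> gives the denominator.\<close>
  have card_eq: "real (card (knockoff_rejections r w \<inter> H)) =
      (\<Sum>i\<in>H. if ereal (w $ i) \<ge> knockoff_threshold r w then 1 else 0)"
    for r H and w :: "real ^ 'm"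
    by (simp add: knockoff_rejections_def sum.If_cases Int_commute)
  show ?thesis
    unfolding fdp_def real_of_nat_max_1 card_eq card_eq[of _ _ UNIV, simplified] by measurable
qed

text \<open>To be evaluated at \<open>v = forget_sign j w\<close>, where \<open>v\<^sub>j \<ge> 0\<close> keeps \<open>j\<close> itself out of the count.\<close>

definition flip_weight :: "real \<Rightarrow> 'm::finite \<Rightarrow> real ^ 'm \<Rightarrow> real" where
  "flip_weight q j v = (if knockoff_threshold q v \<le> ereal (v $ j)
     then 1 / (1 + real (card {k. ereal (v $ k) \<le> - knockoff_threshold q v})) else 0)"

lemma flip_weight_nonneg: "0 \<le> flip_weight q j v"
  by (simp add: flip_weight_def)

lemma flip_weight_le_1: "flip_weight q j v \<le> 1"
  by (simp add: flip_weight_def)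

lemma measurable_flip_weight [measurable]: "flip_weight q j \<in> borel_measurable borel"
proof -
  have card_eq: "real (card {k. ereal (v $ k) \<le> - knockoff_threshold q v}) =
      (\<Sum>k\<in>UNIV. if ereal (v $ k) \<le> - knockoff_threshold q v then 1 else 0)"
    for v :: "real ^ 'm::finite"
    by (simp add: sum.If_cases)
  show ?thesis unfolding flip_weight_def card_eq by measurable
qed

text \<open>Making either score positive moves exactly one index from the negative count at
  \<open>t\<close> to the positive count. The resulting counts do not depend on which of the two was
  flipped.\<close>

lemma estimated_fdp_forget_sign_swap:
  fixes w :: "real ^ 'm::finite"
  assumes "0 < t" "w $ j \<le> - t" "w $ k \<le> - t"
  shows "estimated_fdp (forget_sign j w) t = estimated_fdp (forget_sign k w) t"
proof -
  have N: "N_plus (forget_sign i w) t = Suc (N_plus w t)"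
    "N_minus (forget_sign i w) t = N_minus w t - 1" if "w $ i \<le> - t" for i
  proof -
    have "{l. forget_sign i w $ l \<ge> t} = insert i {l. w $ l \<ge> t}" "i \<notin> {l. w $ l \<ge> t}"
      using that assms(1) by (auto simp: forget_sign_def)
    then show "N_plus (forget_sign i w) t = Suc (N_plus w t)" by (simp add: N_plus_def)
    have "{l. forget_sign i w $ l \<le> - t} = {l. w $ l \<le> - t} - {i}"
      using that assms(1) by (auto simp: forget_sign_def)
    then show "N_minus (forget_sign i w) t = N_minus w t - 1" using that by (simp add: N_minus_def)
  qed
  from N[OF assms(2)] N[OF assms(3)] show ?thesis by (simp add: estimated_fdp_def)
qed

lemma abs_forget_sign: "\<bar>forget_sign j w $ i\<bar> = \<bar>w $ i\<bar>"
  by (simp add: forget_sign_def)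

text \<open>If the threshold for \<open>k\<close> exceeded the one for \<open>j\<close>, the latter
  would be finite, hence attained, and both scores would lie at or below its negative. By the swap
  it would then be feasible for \<open>k\<close> too, a contradiction. Applied in both directions,
  this gives equality.\<close>

lemma knockoff_threshold_forget_sign_le:
  fixes w :: "real ^ 'm::finite"
  assumes j: "knockoff_threshold q (forget_sign j w) \<le> ereal (- (w $ j))"
    and k: "knockoff_threshold q (forget_sign k w) \<le> ereal (- (w $ k))"
  shows "knockoff_threshold q (forget_sign k w) \<le> knockoff_threshold q (forget_sign j w)"
proof (rule ccontr)
  assume less: "\<not> ?thesis"
  then obtain i where i: "forget_sign j w $ i \<noteq> 0" 
      "estimated_fdp (forget_sign j w) \<bar>forget_sign j w $ i\<bar> \<le> q"
      "knockoff_threshold q (forget_sign j w) = ereal \<bar>forget_sign j w $ i\<bar>"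
    by (cases rule: knockoff_threshold_cases[of q "forget_sign j w"]) auto
  let ?t = "\<bar>w $ i\<bar>"
  have T: "knockoff_threshold q (forget_sign j w) = ereal ?t" using i(3) by (simp add: abs_forget_sign)
  have t: "0 < ?t" "w $ i \<noteq> 0" using i(1) abs_forget_sign[of j w i] by auto
  have "w $ j \<le> - ?t" using j T by simp
  moreover have "ereal ?t \<le> ereal (- (w $ k))" using less k T by (metis linear order.trans)
  then have "w $ k \<le> - ?t" by simp
  ultimately have "estimated_fdp (forget_sign k w) ?t \<le> q"
    using estimated_fdp_forget_sign_swap[OF t(1)] i(2) by (metis abs_forget_sign)
  moreover have "forget_sign k w $ i \<noteq> 0" using t(2) abs_forget_sign[of k w i] by auto
  ultimately have "knockoff_threshold q (forget_sign k w) \<le> ereal ?t"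
    using knockoff_threshold_le[of "forget_sign k w" i q] by (simp add: abs_forget_sign)
  with less T show False by simp
qed

text \<open>The contributing indices share one threshold, and each sees all the others in its
  negative count. Hence each weight is at most the reciprocal of their number.\<close>

lemma sum_flip_weight_le_1:
  fixes w :: "real ^ 'm::finite"
  shows "(\<Sum>j\<in>H. if w $ j < 0 then flip_weight q j (forget_sign j w) else 0) \<le> 1"
proof -
  let ?T = "\<lambda>j. knockoff_threshold q (forget_sign j w)"
  \<comment> \<open>For a negative score, coordinate \<open>j\<close> of
    \<open>forget_sign j w\<close> is \<open>- (w $ j)\<close>, so \<open>S\<close> collects exactly
    the nonzero summands.\<close>
  define S where "S = {j \<in> H. w $ j < 0 \<and> ?T j \<le> ereal (- (w $ j))}"
  have T_eq: "?T j = ?T k" if "j \<in> S" "k \<in> S" for j k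
    using that knockoff_threshold_forget_sign_le unfolding S_def by (intro antisym) auto
  have le: "flip_weight q j (forget_sign j w) \<le> 1 / real (card S)" if "j \<in> S" for j
  proof -
    let ?K = "{k. ereal (forget_sign j w $ k) \<le> - ?T j}"
    \<comment> \<open>Index \<open>j\<close> is left out because its own coordinate has become
      positive; the 1 in the denominator of the weight makes up for it.\<close>
    have "S - {j} \<subseteq> ?K"
    proof
      fix k assume k: "k \<in> S - {j}"
      then have "?T j \<le> ereal (- (w $ k))" using T_eq[OF that, of k] by (auto simp: S_def)
      then have "ereal (w $ k) \<le> - ?T j" by (metis ereal_minus_le_minus ereal_uminus_uminus uminus_ereal.simps(1))
      then show "k \<in> ?K" using k by (simp add: forget_sign_def)
    qed
    then have "card (S - {j}) \<le> card ?K" by (intro card_mono) auto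
    then have "card S \<le> 1 + card ?K" using that by (simp add: card_Diff_singleton)
    moreover have "0 < card S" using that by (auto simp: card_gt_0_iff)
    ultimately show ?thesis
      unfolding flip_weight_def by (auto simp: divide_simps simp flip: of_nat_Suc)
  qed
  have "(\<Sum>j\<in>H. if w $ j < 0 then flip_weight q j (forget_sign j w) else 0)
      = (\<Sum>j\<in>S. flip_weight q j (forget_sign j w))"
    by (rule sum.mono_neutral_cong_right)
       (auto simp: S_def flip_weight_def, auto simp: forget_sign_def)
  also have "\<dots> \<le> (\<Sum>j\<in>S. 1 / real (card S))" by (rule sum_mono) (rule le)
  also have "\<dots> \<le> 1" by (cases "S = {}") (auto simp: card_gt_0_iff)
  finally show ?thesis .
qed

text \<open>Rejected scores are positive, so forgetting their sign changes nothing and each weight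
  is 1 / (1 + N_-) at the actual threshold. Feasibility of that threshold bounds 1 / max(N_+, 1) by
  \<open>q\<close> times this weight.\<close>

lemma fdp_knockoff_le_sum_flip_weight:
  fixes w :: "real ^ 'm::finite"
  assumes q: "0 \<le> q"
  shows "fdp H0 (knockoff_rejections q w)
    \<le> q * (\<Sum>j\<in>H0. if 0 < w $ j then flip_weight q j (forget_sign j w) else 0)"
proof (cases rule: knockoff_threshold_cases[of q w])
  case infinite
  then show ?thesis using q
    by (auto simp: fdp_def knockoff_rejections_def intro!: mult_nonneg_nonneg sum_nonneg flip_weight_nonneg)
next
  case (attained i)
  let ?t = "\<bar>w $ i\<bar>" and ?R = "knockoff_rejections q w"
  have R: "?R = {j. ?t \<le> w $ j}" by (simp add: knockoff_rejections_def attained)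
  have pos: "0 < w $ j" if "j \<in> ?R" for j using that attained(1) R by auto
  have fw: "flip_weight q j (forget_sign j w) = 1 / (1 + real (N_minus w ?t))" if "j \<in> ?R" for j
  proof -
    have "forget_sign j w = w" using pos[OF that] by (auto simp: forget_sign_def vec_eq_iff)
    then show ?thesis using that by (simp add: flip_weight_def attained R N_minus_def)
  qed
  have "fdp H0 ?R = (\<Sum>j\<in>?R \<inter> H0. 1 / real (max (N_plus w ?t) 1))"
    by (simp add: fdp_def N_plus_def R)
  also have "\<dots> \<le> (\<Sum>j\<in>?R \<inter> H0. q * flip_weight q j (forget_sign j w))"
    using attained(2) by (intro sum_mono) (auto simp: fw estimated_fdp_def divide_simps mult_ac)
  also have "\<dots> \<le> (\<Sum>j\<in>H0. q * (if 0 < w $ j then flip_weight q j (forget_sign j w) else 0))"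
    using q pos by (intro order.trans[OF eq_refl sum_mono2[of H0 "?R \<inter> H0"]] sum.cong)
      (auto intro!: mult_nonneg_nonneg flip_weight_nonneg)
  finally show ?thesis by (simp add: sum_distrib_left)
qed

section \<open>Conditional sign odds and the bound at a fixed level\<close>

lemma subalgebra_sign_blind_algebra:
  fixes P :: "(real ^ 'm::finite) measure"
  assumes "sets P = sets borel"
  shows "subalgebra P (sign_blind_algebra j)"
proof -
  have sp: "space P = UNIV" using sets_eq_imp_space_eq[OF assms] by simp
  have "forget_sign j \<in> measurable P borel"
    using measurable_forget_sign measurable_cong_sets[OF assms refl] by blast
  from sets_image_in_sets[OF sp this] show ?thesis
    by (simp add: subalgebra_def sign_blind_algebra_def sp)
qed

text \<open>Needed so that the event of small log odds ignores the sign of \<open>w $ j\<close> and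
  can be moved inside a conditional expectation.\<close>

lemma measurable_log_sign_odds_sign_blind:
  "log_sign_odds P j \<in> borel_measurable (sign_blind_algebra j)"
proof -
  have [measurable]: "prob_pos P j \<in> borel_measurable (sign_blind_algebra j)"
    "prob_neg P j \<in> borel_measurable (sign_blind_algebra j)"
    unfolding prob_pos_def prob_neg_def by simp_all
  show ?thesis unfolding log_sign_odds_def[abs_def] by measurable
qed

lemma measurable_log_sign_odds:
  fixes P :: "(real ^ 'm::finite) measure"
  shows "log_sign_odds P j \<in> borel_measurable borel"
  using measurable_from_subalg[OF subalgebra_sign_blind_algebra[of borel j]]
    measurable_log_sign_odds_sign_blind by auto

lemma measurable_max_log_sign_odds [measurable]:
  fixes P :: "(real ^ 'm::finite) measure"
  shows "max_log_sign_odds P H0 \<in> borel_measurable borel"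
  unfolding max_log_sign_odds_def[abs_def] using measurable_log_sign_odds
  by (intro borel_measurable_SUP) auto

text \<open>Apart from the sign indicator, the integrand is sign-blind, so the indicator may be
  replaced by its conditional probability. Where the log odds are at most \<open>ln g\<close>, the
  two conditional probabilities compare with factor \<open>g\<close>.\<close>

lemma integral_pos_le_odds_times_integral_neg:
  fixes P :: "(real ^ 'm::finite) measure"
  assumes "prob_space P" and sets_P [measurable_cong]: "sets P = sets borel"
    and \<phi> [measurable]: "\<phi> \<in> borel_measurable borel"
    and \<phi>_bounds: "\<And>v. 0 \<le> \<phi> v" "\<And>v. \<phi> v \<le> 1"
    and g: "0 < g"
  shows "(\<integral>w. (if 0 < w $ j \<and> log_sign_odds P j w \<le> ereal (ln g) then \<phi> (forget_sign j w) else 0) \<partial>P)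
    \<le> g * (\<integral>w. (if w $ j < 0 then \<phi> (forget_sign j w) else 0) \<partial>P)"
proof -
  interpret prob_space P by fact
  let ?F = "sign_blind_algebra j"
  interpret S: finite_measure_subalgebra P ?F
    by unfold_locales (rule subalgebra_sign_blind_algebra[OF sets_P])
  define f where "f w = (if log_sign_odds P j w \<le> ereal (ln g) then \<phi> (forget_sign j w) else 0)" for w
  have "forget_sign j \<in> measurable ?F borel"
    unfolding sign_blind_algebra_def by (rule measurable_vimage_algebra1) auto
  note [measurable] = this measurable_log_sign_odds_sign_blind
  have fF: "f \<in> borel_measurable ?F" unfolding f_def by measurable
  note [measurable] = measurable_from_subalg[OF S.subalg fF]
  have f_bounds: "0 \<le> f w" "f w \<le> 1" for w using \<phi>_bounds by (auto simp: f_def)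
  have int: "integrable P (\<lambda>w. f w * indicator {w. Q w} w)" if [measurable]: "Measurable.pred borel Q" for Q
    using f_bounds by (intro integrable_const_bound[where B = 1]) (auto simp: indicator_def)
  have pos: "integrable P (\<lambda>w. f w * prob_pos P j w)"
      "(\<integral>w. f w * prob_pos P j w \<partial>P) = (\<integral>w. f w * indicator {w. 0 < w $ j} w \<partial>P)"
    unfolding prob_pos_def using fF by (intro S.real_cond_exp_intg int; measurable)+
  have neg: "integrable P (\<lambda>w. f w * prob_neg P j w)"
      "(\<integral>w. f w * prob_neg P j w \<partial>P) = (\<integral>w. f w * indicator {w. w $ j < 0} w \<partial>P)"
    unfolding prob_neg_def using fF by (intro S.real_cond_exp_intg int; measurable)+
  \<comment> \<open>Versions of conditional probabilities are nonnegative only almost everywhere, so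
    the comparison is integrated in AE form.\<close>
  have nonneg: "AE w in P. 0 \<le> prob_pos P j w" "AE w in P. 0 \<le> prob_neg P j w"
    unfolding prob_pos_def prob_neg_def by (intro S.real_cond_exp_pos; simp)+
  have odds: "f w * prob_pos P j w \<le> g * (f w * prob_neg P j w)"
    if w: "0 \<le> prob_pos P j w" "0 \<le> prob_neg P j w" for w
  proof (cases "log_sign_odds P j w \<le> ereal (ln g)")
    case True
    have "prob_pos P j w \<le> g * prob_neg P j w"
    \<comment> \<open>If \<open>prob_pos\<close> is nonzero, \<open>prob_neg\<close> cannot vanish:
      the log odds would be \<infinity>, against the finite bound. So logarithms can be
      compared.\<close>
    proof (cases "prob_pos P j w = 0")
      case False
      with True w have p: "0 < prob_pos P j w" "0 < prob_neg P j w"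
        and "ln (prob_pos P j w / prob_neg P j w) \<le> ln g"
        by (auto simp: log_sign_odds_def split: if_splits)
      then have "prob_pos P j w / prob_neg P j w \<le> g" using g by simp
      then show ?thesis using p by (simp add: field_simps)
    qed (use w g in auto)
    from mult_left_mono[OF this f_bounds(1)[of w]] show ?thesis by (simp add: mult_ac)
  qed (simp add: f_def)
  have "(\<integral>w. (if 0 < w $ j \<and> log_sign_odds P j w \<le> ereal (ln g) then \<phi> (forget_sign j w) else 0) \<partial>P)
      = (\<integral>w. f w * prob_pos P j w \<partial>P)"
    unfolding pos(2) by (intro Bochner_Integration.integral_cong) (auto simp: f_def)
  also have "\<dots> \<le> (\<integral>w. g * (f w * prob_neg P j w) \<partial>P)"
  proof (rule integral_mono_AE)
    show "AE w in P. f w * prob_pos P j w \<le> g * (f w * prob_neg P j w)"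
      using nonneg by eventually_elim (rule odds)
  qed (use pos(1) neg(1) in auto)
  also have "\<dots> = g * (\<integral>w. f w * indicator {w. w $ j < 0} w \<partial>P)" by (simp add: neg(2))
  \<comment> \<open>The restriction to small odds is dropped on the negative side, leaving sums that
    are bounded pointwise.\<close>
  also have "\<dots> \<le> g * (\<integral>w. (if w $ j < 0 then \<phi> (forget_sign j w) else 0) \<partial>P)"
  proof (intro mult_left_mono integral_mono int)
    show "integrable P (\<lambda>w. if w $ j < 0 then \<phi> (forget_sign j w) else 0)"
      using \<phi>_bounds by (intro integrable_const_bound[where B = 1]) auto
  qed (use g \<phi>_bounds in \<open>auto simp: f_def indicator_def\<close>)
  finally show ?thesis .
qed

text \<open>The bound on the maximum is split into one bound per null index, since only
  \<open>log_sign_odds P j\<close> is known to be blind to the sign of \<open>w $ j\<close>; the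
  maximum may depend on it through other indices.\<close>

lemma expected_fdp_fixed_level:
  fixes P :: "(real ^ 'm::finite) measure"
  assumes "prob_space P" and sets_P [measurable_cong]: "sets P = sets borel"
    and q: "0 \<le> q" and g: "0 < g"
  shows "(\<integral>w. (if max_log_sign_odds P H0 w \<le> ereal (ln g)
      then fdp H0 (knockoff_rejections q w) else 0) \<partial>P) \<le> q * g"
proof -
  interpret prob_space P by fact
  note [measurable] = measurable_log_sign_odds
  let ?f = "\<lambda>w j. flip_weight q j (forget_sign j w)"
  let ?pos = "\<lambda>w j. if 0 < w $ j \<and> log_sign_odds P j w \<le> ereal (ln g) then ?f w j else 0"
  let ?neg = "\<lambda>w j. if w $ j < 0 then ?f w j else 0"
  have int_pos: "integrable P (\<lambda>w. ?pos w j)" for j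
    by (intro integrable_const_bound[where B = 1])
      (auto simp: abs_of_nonneg[OF flip_weight_nonneg] flip_weight_le_1)
  have int_neg: "integrable P (\<lambda>w. ?neg w j)" for j
    by (intro integrable_const_bound[where B = 1])
      (auto simp: abs_of_nonneg[OF flip_weight_nonneg] flip_weight_le_1)
  have "(\<integral>w. (if max_log_sign_odds P H0 w \<le> ereal (ln g)
      then fdp H0 (knockoff_rejections q w) else 0) \<partial>P) \<le> (\<integral>w. q * (\<Sum>j\<in>H0. ?pos w j) \<partial>P)"
  proof (rule integral_mono)
    show "integrable P (\<lambda>w. if max_log_sign_odds P H0 w \<le> ereal (ln g)
        then fdp H0 (knockoff_rejections q w) else 0)"
      by (intro integrable_const_bound[where B = 1]) (auto simp: abs_of_nonneg[OF fdp_nonneg] fdp_le_1)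
    show "integrable P (\<lambda>w. q * (\<Sum>j\<in>H0. ?pos w j))" using int_pos by auto
    show "(if max_log_sign_odds P H0 w \<le> ereal (ln g) then fdp H0 (knockoff_rejections q w) else 0)
        \<le> q * (\<Sum>j\<in>H0. ?pos w j)" for w
    proof (cases "max_log_sign_odds P H0 w \<le> ereal (ln g)")
      case True
      then have "log_sign_odds P j w \<le> ereal (ln g)" if "j \<in> H0" for j
        using that by (auto simp: max_log_sign_odds_def SUP_le_iff)
      then have "(\<Sum>j\<in>H0. ?pos w j) = (\<Sum>j\<in>H0. if 0 < w $ j then ?f w j else 0)"
        by (intro sum.cong) auto
      with True fdp_knockoff_le_sum_flip_weight[OF q, of H0 w] show ?thesis by simp
    qed (auto intro!: mult_nonneg_nonneg sum_nonneg q flip_weight_nonneg)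
  qed
  also have "\<dots> = q * (\<Sum>j\<in>H0. \<integral>w. ?pos w j \<partial>P)" using int_pos by simp
  also have "\<dots> \<le> q * (\<Sum>j\<in>H0. g * (\<integral>w. ?neg w j \<partial>P))"
    using q g flip_weight_nonneg flip_weight_le_1
    by (intro mult_left_mono sum_mono integral_pos_le_odds_times_integral_neg assms) auto
  also have "\<dots> = q * g * (\<integral>w. (\<Sum>j\<in>H0. ?neg w j) \<partial>P)"
    using int_neg by (simp add: sum_distrib_left mult_ac)
  also have "(\<integral>w. (\<Sum>j\<in>H0. ?neg w j) \<partial>P) \<le> (\<integral>w. 1 \<partial>P)"
    using int_neg by (intro integral_mono sum_flip_weight_le_1) auto
  then have "q * g * (\<integral>w. (\<Sum>j\<in>H0. ?neg w j) \<partial>P) \<le> q * g * 1"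
    using q g by (intro mult_left_mono) (auto simp: prob_space)
  finally show ?thesis by simp
qed

text \<open>The analogous \<open>indep_var_distribution_eq\<close> requires both variables to have the same type.\<close>

lemma (in prob_space) distr_pair_eq_of_indep_set:
  assumes indep: "indep_set \<A> \<B>"
    and X [measurable]: "X \<in> measurable M S" and Y [measurable]: "Y \<in> measurable M T"
    and X_in: "\<And>A. A \<in> sets S \<Longrightarrow> X -` A \<inter> space M \<in> \<A>"
    and Y_in: "\<And>B. B \<in> sets T \<Longrightarrow> Y -` B \<inter> space M \<in> \<B>"
  shows "distr M S X \<Otimes>\<^sub>M distr M T Y = distr M (S \<Otimes>\<^sub>M T) (\<lambda>\<omega>. (X \<omega>, Y \<omega>))"
proof (rule pair_measure_eqI)
  interpret X: prob_space "distr M S X" by (rule prob_space_distr) measurable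
  interpret Y: prob_space "distr M T Y" by (rule prob_space_distr) measurable
  show "sigma_finite_measure (distr M S X)" "sigma_finite_measure (distr M T Y)" by unfold_locales
  fix A B assume "A \<in> sets (distr M S X)" "B \<in> sets (distr M T Y)"
  then have AB [measurable]: "A \<in> sets S" "B \<in> sets T" by simp_all
  have "(\<lambda>\<omega>. (X \<omega>, Y \<omega>)) -` (A \<times> B) \<inter> space M = (X -` A \<inter> space M) \<inter> (Y -` B \<inter> space M)"
    by auto
  then show "emeasure (distr M S X) A * emeasure (distr M T Y) B =
      emeasure (distr M (S \<Otimes>\<^sub>M T) (\<lambda>\<omega>. (X \<omega>, Y \<omega>))) (A \<times> B)"
    using indep_setD[OF indep X_in[OF AB(1)] Y_in[OF AB(2)]]
    by (simp add: emeasure_distr emeasure_eq_measure ennreal_mult)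
qed simp

section \<open>Random level: integration over the calibration data\<close>

theorem corollary7:
  fixes M :: "'a measure" and N :: "'d measure"
    and W :: "'a \<Rightarrow> real ^ 'm::finite" and D :: "'a \<Rightarrow> 'd"
    and H0 :: "'m set" and \<Gamma> :: "'a \<Rightarrow> ereal" and A :: "'a set"
    and \<alpha> \<delta> \<eta> :: real
  defines "\<sigma>D \<equiv> vimage_algebra (space M) D N"
    and "\<sigma>W \<equiv> vimage_algebra (space M) W borel"
    and "\<Lambda>\<^sub>m\<^sub>a\<^sub>x \<equiv> max_log_sign_odds (distr M borel W) H0"
  assumes "prob_space M"
    and W: "W \<in> borel_measurable M"
    and null_nonzero: "\<And>j. j \<in> H0 \<Longrightarrow> AE \<omega> in M. W \<omega> $ j \<noteq> 0"
    and alpha: "0 < \<alpha>" "\<alpha> < 1"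
    and delta: "0 \<le> \<delta>" "\<delta> < 1"
    and eta: "0 \<le> \<eta>" "\<eta> < 1"
    and budget: "\<delta> + \<eta> < \<alpha>"
    and D: "D \<in> measurable M N"
    and indep: "prob_space.indep_set M (sets \<sigma>D) (sets \<sigma>W)"
    and Gamma_measurable: "\<Gamma> \<in> borel_measurable \<sigma>D"
    and Gamma_ge_1: "\<And>\<omega>. \<omega> \<in> space M \<Longrightarrow> 1 \<le> \<Gamma> \<omega>"
    and A: "A \<in> sets \<sigma>D" "measure M A \<ge> 1 - \<eta>"
    and calibration: "AE \<omega> in M. \<omega> \<in> A \<longrightarrow> \<Gamma> \<omega> < \<infinity> \<longrightarrow>
      real_cond_exp M \<sigma>D
        (indicator {\<omega>' \<in> space M. \<Lambda>\<^sub>m\<^sub>a\<^sub>x (W \<omega>') > log_ereal (\<Gamma> \<omega>')}) \<omega> \<le> \<delta>"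
  shows "FDR M H0 (\<lambda>\<omega>. knockoff_rejections (run_level \<alpha> \<delta> \<eta> (\<Gamma> \<omega>)) (W \<omega>)) \<le> \<alpha>"
proof -
  interpret prob_space M by fact
  define P where "P = distr M borel W"
  have P: "prob_space P" "sets P = sets borel" "space P = UNIV"
    unfolding P_def using prob_space_distr[OF W] by auto
  have sub: "subalgebra M \<sigma>D"
    unfolding subalgebra_def \<sigma>D_def using D by (auto simp: sets_image_in_sets)
  interpret S: finite_measure_subalgebra M \<sigma>D by unfold_locales (rule sub)
  have Gamma_M: "\<Gamma> \<in> borel_measurable M" by (rule measurable_from_subalg[OF sub Gamma_measurable])
  have A_M: "A \<in> sets M" using A(1) sub by (auto simp: subalgebra_def)
  note [measurable] = W Gamma_M A_M
  have L_meas [measurable]: "\<Lambda>\<^sub>m\<^sub>a\<^sub>x \<in> borel_measurable borel"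
    unfolding \<Lambda>\<^sub>m\<^sub>a\<^sub>x_def by measurable
  have log_meas [measurable]: "log_ereal \<in> borel_measurable borel"
    unfolding log_ereal_def[abs_def] by measurable
  have run_meas [measurable]: "run_level \<alpha> \<delta> \<eta> \<in> borel_measurable borel"
    unfolding run_level_def[abs_def] by measurable

  \<comment> \<open>\<open>\<Gamma>\<close> is measurable for the data algebra, so independence
    makes its joint law with \<open>W\<close> a product.\<close>
  have joint: "distr M borel \<Gamma> \<Otimes>\<^sub>M P = distr M (borel \<Otimes>\<^sub>M borel) (\<lambda>\<omega>. (\<Gamma> \<omega>, W \<omega>))"
    unfolding P_def
  proof (rule distr_pair_eq_of_indep_set[OF _ Gamma_M W])
    show "indep_set (sets \<sigma>D) (sets \<sigma>W)" by (rule indep)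
    show "\<Gamma> -` B \<inter> space M \<in> sets \<sigma>D" if "B \<in> sets borel" for B
      using measurable_sets[OF Gamma_measurable that] by (simp add: \<sigma>D_def)
    show "W -` B \<inter> space M \<in> sets \<sigma>W" if "B \<in> sets borel" for B
      using that unfolding \<sigma>W_def by (rule in_vimage_algebra)
  qed

  define FP where "FP \<gamma> w = fdp H0 (knockoff_rejections (run_level \<alpha> \<delta> \<eta> \<gamma>) w)" for \<gamma> and w :: "real ^ 'm"
  have FP_meas [measurable]: "(\<lambda>x. FP (f x) (g x)) \<in> borel_measurable K"
    if [measurable]: "f \<in> borel_measurable K" "g \<in> borel_measurable K" for K :: "'k measure" and f g
    unfolding FP_def by measurable
  have FP_bounds: "0 \<le> FP \<gamma> w" "FP \<gamma> w \<le> 1" for \<gamma> w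
    unfolding FP_def by (rule fdp_nonneg fdp_le_1)+
  \<comment> \<open>\<open>h\<close> keeps the proportion only where the odds bound holds. The guard
    on \<gamma> makes the section bound valid for every \<gamma>, not only for values of
    \<open>\<Gamma>\<close>.\<close>
  define h where "h = (\<lambda>(\<gamma>, w). if 1 \<le> \<gamma> \<and> \<gamma> < \<infinity> \<and> \<Lambda>\<^sub>m\<^sub>a\<^sub>x w \<le> log_ereal \<gamma> then FP \<gamma> w else 0)"
  have h_meas [measurable]: "h \<in> borel_measurable (borel \<Otimes>\<^sub>M borel)"
    unfolding h_def by measurable
  have h_bounds: "0 \<le> h x" "h x \<le> 1" for x
    using FP_bounds by (auto simp: h_def split: prod.split)
  let ?c = "\<alpha> - \<delta> - \<eta>"

  have h_section: "(\<integral>w. h (\<gamma>, w) \<partial>P) \<le> ?c" for \<gamma>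
  proof (cases "1 \<le> \<gamma> \<and> \<gamma> < \<infinity>")
    case True
    then obtain g where g: "\<gamma> = ereal g" "1 \<le> g" by (cases \<gamma>) (auto simp: one_ereal_def)
    have "(\<integral>w. h (\<gamma>, w) \<partial>P) = (\<integral>w. (if max_log_sign_odds P H0 w \<le> ereal (ln g)
        then fdp H0 (knockoff_rejections (?c / g) w) else 0) \<partial>P)"
      using g by (simp add: h_def FP_def run_level_def log_ereal_def \<Lambda>\<^sub>m\<^sub>a\<^sub>x_def P_def one_ereal_def cong: if_cong)
    \<comment> \<open>The run level is the budget divided by \<open>g\<close>, which cancels the
      cost of the sign flips.\<close>
    also have "\<dots> \<le> (?c / g) * g"
      using g budget by (intro expected_fdp_fixed_level P) auto
    finally show ?thesis using g by simp
  next
    case False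
    then have "h (\<gamma>, w) = 0" for w by (auto simp: h_def)
    then show ?thesis using budget by simp
  qed
  have h_le: "(\<integral>\<omega>. h (\<Gamma> \<omega>, W \<omega>) \<partial>M) \<le> ?c"
  proof -
    interpret G: prob_space "distr M borel \<Gamma>" by (rule prob_space_distr) measurable
    interpret P: prob_space P by fact
    interpret GP: pair_prob_space "distr M borel \<Gamma>" P ..
    have [measurable]: "h \<in> borel_measurable (distr M borel \<Gamma> \<Otimes>\<^sub>M P)"
      unfolding joint by simp
    have int: "integrable (distr M borel \<Gamma> \<Otimes>\<^sub>M P) h"
      using h_bounds by (intro GP.P.integrable_const_bound[where B = 1]) auto
    have "(\<integral>\<omega>. h (\<Gamma> \<omega>, W \<omega>) \<partial>M) = (\<integral>x. h x \<partial>(distr M borel \<Gamma> \<Otimes>\<^sub>M P))"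
      unfolding joint by (subst integral_distr) auto
    also have "\<dots> = (\<integral>\<gamma>. (\<integral>w. h (\<gamma>, w) \<partial>P) \<partial>distr M borel \<Gamma>)"
      using GP.integral_fst'[OF int] by simp
    also have "\<dots> \<le> (\<integral>\<gamma>. ?c \<partial>distr M borel \<Gamma>)"
      using GP.integrable_fst'[OF int] h_section by (intro integral_mono) auto
    finally show ?thesis using G.prob_space by simp
  qed

  define E where "E = {\<omega> \<in> space M. \<Lambda>\<^sub>m\<^sub>a\<^sub>x (W \<omega>) > log_ereal (\<Gamma> \<omega>)}"
  \<comment> \<open>The calibration bound is available only on \<open>A\<close> with
    \<open>\<Gamma>\<close> finite. This set lies in the data algebra, so conditional expectations
    can be integrated over it.\<close>
  define B where "B = A \<inter> {\<omega> \<in> space M. \<Gamma> \<omega> < \<infinity>}"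
  have E_M [measurable]: "E \<in> sets M" unfolding E_def by measurable
  have B_D: "B \<in> sets \<sigma>D"
  proof -
    have "space \<sigma>D = space M" by (simp add: \<sigma>D_def)
    moreover have "{\<omega> \<in> space \<sigma>D. \<Gamma> \<omega> < \<infinity>} \<in> sets \<sigma>D"
      using Gamma_measurable by measurable
    ultimately show ?thesis unfolding B_def using A(1) by auto
  qed
  have B_M [measurable]: "B \<in> sets M" unfolding B_def by measurable
  have int_ind: "integrable M (indicator C :: 'a \<Rightarrow> real)" if "C \<in> sets M" for C
    using that by (intro integrable_real_indicator) (auto simp: emeasure_eq_measure)
  note int_E = int_ind[OF E_M]
  have BE_le: "measure M (B \<inter> E) \<le> \<delta>"
  proof -
    have "measure M (B \<inter> E) = (\<integral>\<omega>\<in>B. indicator E \<omega> \<partial>M)"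
      unfolding set_lebesgue_integral_def by (simp flip: indicator_inter_arith)
    also have "\<dots> = (\<integral>\<omega>\<in>B. real_cond_exp M \<sigma>D (indicator E) \<omega> \<partial>M)"
      by (rule S.real_cond_exp_intA[OF int_E B_D])
    also have "\<dots> \<le> (\<integral>\<omega>. \<delta> \<partial>M)"
      unfolding set_lebesgue_integral_def
    proof (rule integral_mono_AE)
      show "integrable M (\<lambda>\<omega>. indicator B \<omega> *\<^sub>R real_cond_exp M \<sigma>D (indicator E) \<omega>)"
        using S.real_cond_exp_int(1)[OF int_E] by (intro integrable_mult_indicator) auto
      \<comment> \<open>Outside \<open>B\<close> the integrand is 0, hence also at most
        \<delta>.\<close>
      show "AE \<omega> in M. indicator B \<omega> *\<^sub>R real_cond_exp M \<sigma>D (indicator E) \<omega> \<le> \<delta>"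
        using calibration unfolding E_def[symmetric]
        by eventually_elim (use delta in \<open>auto simp: B_def indicator_def\<close>)
    qed simp
    finally show ?thesis by (simp add: prob_space)
  qed
  have A_le: "measure M (space M - A) \<le> \<eta>"
    using A(2) prob_compl[OF A_M] by simp
  \<comment> \<open>The summands cover controlled odds, failed odds on \<open>B\<close>, and failure
    of \<open>A\<close>. The remaining case, infinite \<open>\<Gamma>\<close>, has no
    rejections.\<close>
  have pointwise: "FP (\<Gamma> \<omega>) (W \<omega>) \<le> h (\<Gamma> \<omega>, W \<omega>) + indicator (B \<inter> E) \<omega> + indicator (space M - A) \<omega>"
    if \<omega>: "\<omega> \<in> space M" for \<omega>
  proof (cases "\<omega> \<in> A \<and> \<Gamma> \<omega> < \<infinity> \<and> \<Lambda>\<^sub>m\<^sub>a\<^sub>x (W \<omega>) \<le> log_ereal (\<Gamma> \<omega>)")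
    case True
    then show ?thesis using Gamma_ge_1[OF \<omega>] by (simp add: h_def)
  next
    case False
    show ?thesis
    proof (cases "\<Gamma> \<omega> = \<infinity>")
      case True
      then have "FP (\<Gamma> \<omega>) (W \<omega>) = 0"
        by (simp add: FP_def run_level_def fdp_def knockoff_rejections_def knockoff_threshold_nonpos_level)
      then show ?thesis using h_bounds by (simp add: add_nonneg_nonneg)
    next
      case fin: False
      then have "\<omega> \<in> B \<inter> E \<or> \<omega> \<in> space M - A" using False \<omega> by (auto simp: B_def E_def not_le)
      then have "1 \<le> indicator (B \<inter> E) \<omega> + (indicator (space M - A) \<omega> :: real)"
        by (auto simp: indicator_def)
      then show ?thesis using FP_bounds(2)[of "\<Gamma> \<omega>" "W \<omega>"] h_bounds(1)[of "(\<Gamma> \<omega>, W \<omega>)"] by linarith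
    qed
  qed
  have int_h: "integrable M (\<lambda>\<omega>. h (\<Gamma> \<omega>, W \<omega>))"
    using h_bounds by (intro integrable_const_bound[where B = 1]) auto
  have "(\<integral>\<omega>. FP (\<Gamma> \<omega>) (W \<omega>) \<partial>M)
      \<le> (\<integral>\<omega>. h (\<Gamma> \<omega>, W \<omega>) + indicator (B \<inter> E) \<omega> + indicator (space M - A) \<omega> \<partial>M)"
  proof (rule integral_mono)
    show "integrable M (\<lambda>\<omega>. FP (\<Gamma> \<omega>) (W \<omega>))"
      using FP_bounds by (intro integrable_const_bound[where B = 1]) auto
    show "integrable M (\<lambda>\<omega>. h (\<Gamma> \<omega>, W \<omega>) + indicator (B \<inter> E) \<omega> + indicator (space M - A) \<omega>)"
      using int_h by (intro Bochner_Integration.integrable_add int_ind) auto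
  qed (rule pointwise)
  also have "\<dots> = (\<integral>\<omega>. h (\<Gamma> \<omega>, W \<omega>) \<partial>M) + measure M (B \<inter> E) + measure M (space M - A)"
    using int_h int_ind[of "B \<inter> E"] int_ind[of "space M - A"]
    by (subst Bochner_Integration.integral_add; (simp add: sets.sets_into_space Int_absorb2)?)+
  \<comment> \<open>The three bounds \<alpha> - \<delta> - \<eta>, \<delta> and \<eta> add up to
    \<alpha>.\<close>
  also have "\<dots> \<le> \<alpha>" using h_le BE_le A_le by simp
  finally show ?thesis by (simp add: FDR_def FP_def fdp_def)
qed

end
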